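(* Let $\mathcal{E}$ be a $\mathcal{G}$-consistent coherent sublinear expectation (with conditional map $\mathcal{E}_{\mathcal{G}}$), with a representation $\mathcal{E}(\cdot)=\sup_{\theta\in\Theta}E_\theta[\cdot]$ such that $\Theta$ has the Hahn property on $\mathcal{G}$. Then for every $X\in L^1(\mathcal{E};\mathcal{F})$, $$\mathcal{E}_{\mathcal{G}}(X)=\Theta\text{-ess sup}_{\theta\in\Theta}\{E_{\theta|\Theta}[X|\mathcal{G}]\}\quad\text{q.s.}$$
   Context: Setting: $(\Omega,\mathcal{F})$ is a measurable space, $\mathcal{G}\subseteq\mathcal{F}$ a sub-$\sigma$-algebra, $\Theta$ a collection of probability measures on $(\Omega,\mathcal{F})$. $\Theta|_{\mathcal{G}}$ is the set of restrictions $\theta|_{\mathcal{G}}$ of the measures $\theta\in\Theta$ to $\mathcal{G}$. For a $\sigma$-algebra $\mathcal{A}$ and a collection $\Psi$ of probability measures defined on $\mathcal{A}$ (or on a larger $\sigma$-algebra and restricted to $\mathcal{A}$), $\mathcal{A}^\psi$ is the completion of $\mathcal{A}$ under $\psi$, $\mathcal{A}^\Psi=\bigcap_{\psi\in\Psi}\mathcal{A}^\psi$, and $m\mathcal{A}^\Psi$ is the set of $\mathcal{A}^\Psi$-measurable real functions on $\Omega$ (extended-real values are allowed where essential suprema are taken). Each $\psi\in\Psi$ extends uniquely to $\mathcal{A}^\Psi$. A set $N\in\mathcal{A}^\Psi$ is $\Psi$-polar if $\psi(N)=0$ for all $\psi\in\Psi$. "Polar" means $\Theta$-polar; a statement holds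 quasi-surely (q.s.) if it holds except on a polar set. Sublinear expectations: for $\mathcal{A}\in\{\mathcal{F},\mathcal{G}\}$, $\mathcal{H}_{\mathcal{A}}$ is the set of $X\in m\mathcal{A}^\Theta$ such that for all $\theta\in\Theta$ at least one of $E_\theta[X^+],E_\theta[X^-]$ is finite. $\mathcal{E}$ has representation $\Theta$ if $\mathcal{E}(X)=\sup_{\theta\in\Theta}E_\theta[X]$ for $X\in\mathcal{H}_{\mathcal{F}}$ (values in $\mathbb{R}\cup\{\pm\infty\}$). $L^1(\mathcal{E};\mathcal{A})$ is the set of $X\in m\mathcal{A}^\Theta$ with $\sup_{\theta\in\Theta}E_\theta[|X|]<\infty$. A coherent sublinear expectation is a map $\mathcal{E}$ that is monotone ($X\ge Y$ implies $\mathcal{E}(X)\ge\mathcal{E}(Y)$), satisfies $\mathcal{E}(c)=c$ and $\mathcal{E}(X+c)=\mathcal{E}(X)+c$ for constants $c$, $\mathcal{E}(cX)=c\mathcal{E}(X)$ for constants $c>0$, $\mathcal{E}(X+Y)\le\mathcal{E}(X)+\mathcal{E}(Y)$ (when all terms are well defined), and $\mathcal{E}(X_n)\uparrow\mathcal{E}(X)$ for nonnegative $X_n$ increasing pointwise to $X$. $\mathcal{G}$-consistency: a coherent sublinear expectation $\mathcal{E}$ on $\mathcal{H}_{\mathcal{F}}$ together with a map $\mathcal{E}_{\mathcal{G}}:L^1(\mathcal{E};\mathcal{F})\to L^1(\mathcal{E};\mathcal{G})$ is $\mathcal{G}$-consistent if for all $X,Y\in L^1(\mathcal{E};\mathcal{F})$: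 (recursivity) $\mathcal{E}(\mathcal{E}_{\mathcal{G}}(X))=\mathcal{E}(X)$; (regularity) $\mathcal{E}_{\mathcal{G}}(I_AY)=I_A\mathcal{E}_{\mathcal{G}}(Y)$ q.s. for all $A\in\mathcal{G}^\Theta$; (monotonicity) $X\ge Y$ implies $\mathcal{E}_{\mathcal{G}}(X)\ge\mathcal{E}_{\mathcal{G}}(Y)$ q.s.; (triviality) $\mathcal{E}_{\mathcal{G}}(Y)=Y$ q.s. for all $Y\in L^1(\mathcal{E};\mathcal{G})$; (cash additivity) $\mathcal{E}_{\mathcal{G}}(X+Y)=\mathcal{E}_{\mathcal{G}}(X)+Y$ q.s. for all $Y\in L^1(\mathcal{E};\mathcal{G})$; (sublinearity) $\mathcal{E}_{\mathcal{G}}(X+Y)\le\mathcal{E}_{\mathcal{G}}(X)+\mathcal{E}_{\mathcal{G}}(Y)$ q.s.; (coherence) $\mathcal{E}_{\mathcal{G}}(\lambda Y)=\lambda^+\mathcal{E}_{\mathcal{G}}(Y)+\lambda^-\mathcal{E}_{\mathcal{G}}(-Y)$ q.s. for all $\lambda\in m\mathcal{G}^\Theta$ with $\lambda Y\in L^1(\mathcal{E};\mathcal{G})$. Hahn property: $\Theta$ has the Hahn property on $\mathcal{G}$ if there is a set $\Phi$ (not necessarily countable) of probability measures on $(\Omega,\mathcal{G})$ such that (i) $\Phi$ and $\Theta|_{\mathcal{G}}$ generate the same polar sets and $m\mathcal{G}^\Theta=m\mathcal{G}^\Phi$; (ii) for every $\phi\in\Phi$ there is a set $S_{(\phi,\mathcal{G})}\in\mathcal{G}^\Theta$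 with $\phi(S_{(\phi,\mathcal{G})})=1$, and the sets $\{S_{(\phi,\mathcal{G})}\}_{\phi\in\Phi}$ are disjoint. Fix such a $\Phi$ and such sets. $\Theta$-essential supremum: for a family $\mathcal{X}$ of $\mathcal{G}^\Theta$-measurable functions, $\Theta\text{-ess sup}\,\mathcal{X}$ is the q.s. unique $\mathcal{G}^\Theta$-measurable (extended-real) $X^*$ such that $X^*\ge X$ q.s. for all $X\in\mathcal{X}$, and any other such function $Y$ with this property satisfies $Y\ge X^*$ q.s. (Under the Hahn property it exists.) Supports of $\theta\in\Theta$: under the Hahn property, $\theta|_{\mathcal{G}}$ is absolutely continuous with respect to $\phi$ on $S_{(\phi,\mathcal{G})}$ for each $\phi\in\Phi$. Put $\lambda_{\theta|\phi}:=\frac{d\theta|_{\mathcal{G}}}{d\phi}I_{S_{(\phi,\mathcal{G})}}$ (defined up to a polar set), and define the $\mathcal{G}^\Theta$-measurable support of $\theta$ by $S_{(\theta,\mathcal{G})}:=\{\omega:\Theta\text{-ess sup}_{\phi\in\Phi}(\lambda_{\theta|\phi})>0\}\in\mathcal{G}^\Theta$, defined up to a polar set. As the name "support" indicates, it is understood that $\theta(S_{(\theta,\mathcal{G})})=1$. Quasi-sure linear conditional expectation: for $\theta\in\Theta$, $E_{\theta|\Theta}[X|\mathcal{G}]$ equals $Y$ on $S_{(\theta,\mathcal{G})}$ and $-\infty$ off $S_{(\theta,\mathcal{G})}$, where $Y\in m\mathcal{G}^\Theta$ is any version of the classical conditional expectation $E_\theta[X|\mathcal{G}]$; this is unique up to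 a polar set. *)

theory Defs
  imports "HOL-Probability.Probability"
begin

text \<open>
  Measurable spaces \<open>(\<Omega>, \<A>)\<close> are given as measures whose \<^const>\<open>emeasure\<close> is irrelevant; only
  \<^const>\<open>space\<close> and \<^const>\<open>sets\<close> are used.  In particular \<open>qs_algebra A \<Psi>\<close> carries the
  sigma-algebra \<open>\<A>\<^sup>\<Psi>\<close>, the intersection over \<open>\<psi> \<in> \<Psi>\<close> of the completions of \<open>\<A>\<close>
  under \<open>\<psi>\<close>.  The measures in \<open>\<Psi>\<close> may live on a sigma-algebra larger than \<open>\<A>\<close>; they are
  restricted to \<open>\<A>\<close> before completing.
\<close>

definition qs_algebra :: "'a measure \<Rightarrow> 'a measure set \<Rightarrow> 'a measure" where
  "qs_algebra A \<Psi> = sigma (space A)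
     {N. N \<subseteq> space A \<and> (\<forall>\<psi>\<in>\<Psi>. N \<in> sets (completion (restr_to_subalg \<psi> A)))}"

text \<open>The extension of \<open>\<psi> \<in> \<Psi>\<close> to \<open>\<A>\<^sup>\<Psi>\<close>.\<close>

definition qs_extension :: "'a measure \<Rightarrow> 'a measure set \<Rightarrow> 'a measure \<Rightarrow> 'a measure" where
  "qs_extension A \<Psi> \<psi> =
     restr_to_subalg (completion (restr_to_subalg \<psi> A)) (qs_algebra A \<Psi>)"

lemma space_qs_algebra [simp]: "space (qs_algebra A \<Psi>) = space A"
  unfolding qs_algebra_def by (rule space_measure_of) auto

lemma sets_qs_algebra:
  assumes "\<And>\<psi>. \<psi> \<in> \<Psi> \<Longrightarrow> subalgebra \<psi> A"
  shows "sets (qs_algebra A \<Psi>) =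
    {N. N \<subseteq> space A \<and> (\<forall>\<psi>\<in>\<Psi>. N \<in> sets (completion (restr_to_subalg \<psi> A)))}"
    (is "_ = ?S")
proof -
  have sp: "space (completion (restr_to_subalg \<psi> A)) = space A" if "\<psi> \<in> \<Psi>" for \<psi>
    using assms[OF that] unfolding subalgebra_def space_completion space_restr_to_subalg by simp
  have "sigma_algebra (space A) ?S"
    unfolding sigma_algebra_iff2
  proof (intro conjI ballI allI impI)
    show "?S \<subseteq> Pow (space A)" by auto
    show "{} \<in> ?S" using sets.empty_sets by blast
    show "space A - s \<in> ?S" if "s \<in> ?S" for s
    proof -
      have "space A - s \<in> sets (completion (restr_to_subalg \<psi> A))" if "\<psi> \<in> \<Psi>" for \<psi>
      proof -
        have "s \<in> sets (completion (restr_to_subalg \<psi> A))" using \<open>s \<in> ?S\<close> that by blast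
        from sets.compl_sets[OF this] show ?thesis unfolding sp[OF that] .
      qed
      then show ?thesis by blast
    qed
    show "(\<Union>i::nat. X i) \<in> ?S" if "range X \<subseteq> ?S" for X
    proof -
      have "(\<Union>i. X i) \<in> sets (completion (restr_to_subalg \<psi> A))" if "\<psi> \<in> \<Psi>" for \<psi>
        by (rule sets.countable_UN) (use \<open>range X \<subseteq> ?S\<close> that in blast)
      moreover have "(\<Union>i. X i) \<subseteq> space A" using that by blast
      ultimately show ?thesis by blast
    qed
  qed
  then show ?thesis
    unfolding qs_algebra_def by (rule sigma_algebra.sets_measure_of_eq)
qed

lemma subalgebra_completion_qs_algebra:
  assumes "\<And>\<psi>. \<psi> \<in> \<Psi> \<Longrightarrow> subalgebra \<psi> A" and "\<psi> \<in> \<Psi>"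
  shows "subalgebra (completion (restr_to_subalg \<psi> A)) (qs_algebra A \<Psi>)"
proof -
  have "space (completion (restr_to_subalg \<psi> A)) = space A"
    using assms(1)[OF assms(2)] unfolding subalgebra_def space_completion space_restr_to_subalg
    by simp
  moreover have "sets (qs_algebra A \<Psi>) \<subseteq> sets (completion (restr_to_subalg \<psi> A))"
  proof -
    have "sets (qs_algebra A \<Psi>) =
      {N. N \<subseteq> space A \<and> (\<forall>\<psi>\<in>\<Psi>. N \<in> sets (completion (restr_to_subalg \<psi> A)))}"
      by (rule sets_qs_algebra) (rule assms(1))
    then show ?thesis using assms(2) by blast
  qed
  ultimately show ?thesis unfolding subalgebra_def by simp
qed

lemma sets_qs_extension:
  assumes "\<And>\<psi>. \<psi> \<in> \<Psi> \<Longrightarrow> subalgebra \<psi> A" and "\<psi> \<in> \<Psi>"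
  shows "sets (qs_extension A \<Psi> \<psi>) = sets (qs_algebra A \<Psi>)"
  unfolding qs_extension_def
  by (rule sets_restr_to_subalg, rule subalgebra_completion_qs_algebra) (fact assms)+

lemma emeasure_qs_extension:
  assumes "\<And>\<psi>. \<psi> \<in> \<Psi> \<Longrightarrow> subalgebra \<psi> A" and "\<psi> \<in> \<Psi>" and "N \<in> sets (qs_algebra A \<Psi>)"
  shows "emeasure (qs_extension A \<Psi> \<psi>) N = emeasure (completion (restr_to_subalg \<psi> A)) N"
  unfolding qs_extension_def
  by (rule emeasure_restr_to_subalg, rule subalgebra_completion_qs_algebra) (fact assms)+

definition polar :: "'a measure \<Rightarrow> 'a measure set \<Rightarrow> 'a set \<Rightarrow> bool" where
  "polar A \<Psi> N \<longleftrightarrow>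
     N \<in> sets (qs_algebra A \<Psi>) \<and> (\<forall>\<psi>\<in>\<Psi>. emeasure (qs_extension A \<Psi> \<psi>) N = 0)"

definition quasi_surely :: "'a measure \<Rightarrow> 'a measure set \<Rightarrow> ('a \<Rightarrow> bool) \<Rightarrow> bool" where
  "quasi_surely F \<Theta> P \<longleftrightarrow> (\<exists>N. polar F \<Theta> N \<and> {\<omega> \<in> space F. \<not> P \<omega>} \<subseteq> N)"

text \<open>The expectation \<open>E[X\<^sup>+] - E[X\<^sup>-]\<close>, meaningful when one of the two terms is finite.\<close>

definition ext_expectation :: "'a measure \<Rightarrow> ('a \<Rightarrow> real) \<Rightarrow> ereal" where
  "ext_expectation M X =
     enn2ereal (\<integral>\<^sup>+\<omega>. ennreal (X \<omega>) \<partial>M) - enn2ereal (\<integral>\<^sup>+\<omega>. ennreal (- X \<omega>) \<partial>M)"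

definition H_space :: "'a measure \<Rightarrow> 'a measure set \<Rightarrow> ('a \<Rightarrow> real) set" where
  "H_space A \<Theta> = {X \<in> borel_measurable (qs_algebra A \<Theta>). \<forall>\<theta>\<in>\<Theta>.
      (\<integral>\<^sup>+\<omega>. ennreal (X \<omega>) \<partial>qs_extension A \<Theta> \<theta>) < \<infinity> \<or>
      (\<integral>\<^sup>+\<omega>. ennreal (- X \<omega>) \<partial>qs_extension A \<Theta> \<theta>) < \<infinity>}"

definition L1_space :: "'a measure \<Rightarrow> 'a measure set \<Rightarrow> 'a measure \<Rightarrow> ('a \<Rightarrow> real) set" where
  "L1_space F \<Theta> A = {X \<in> borel_measurable (qs_algebra A \<Theta>).
      (SUP \<theta>\<in>\<Theta>. \<integral>\<^sup>+\<omega>. ennreal \<bar>X \<omega>\<bar> \<partial>qs_extension F \<Theta> \<theta>) < \<infinity>}"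

definition represents ::
  "'a measure \<Rightarrow> 'a measure set \<Rightarrow> (('a \<Rightarrow> real) \<Rightarrow> ereal) \<Rightarrow> bool" where
  "represents F \<Theta> \<E> \<longleftrightarrow>
     (\<forall>X\<in>H_space F \<Theta>. \<E> X = (SUP \<theta>\<in>\<Theta>. ext_expectation (qs_extension F \<Theta> \<theta>) X))"

definition coherent_sublinear_expectation ::
  "'a measure \<Rightarrow> 'a measure set \<Rightarrow> (('a \<Rightarrow> real) \<Rightarrow> ereal) \<Rightarrow> bool" where
  "coherent_sublinear_expectation F \<Theta> \<E> \<longleftrightarrow>
     (\<forall>X\<in>H_space F \<Theta>. \<forall>Y\<in>H_space F \<Theta>. (\<forall>\<omega>\<in>space F. X \<omega> \<ge> Y \<omega>) \<longrightarrow> \<E> X \<ge> \<E> Y) \<and>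
     (\<forall>c::real. \<E> (\<lambda>_. c) = ereal c) \<and>
     (\<forall>X\<in>H_space F \<Theta>. \<forall>c::real. \<E> (\<lambda>\<omega>. X \<omega> + c) = \<E> X + ereal c) \<and>
     (\<forall>X\<in>H_space F \<Theta>. \<forall>c::real. c > 0 \<longrightarrow> \<E> (\<lambda>\<omega>. c * X \<omega>) = ereal c * \<E> X) \<and>
     (\<forall>X\<in>H_space F \<Theta>. \<forall>Y\<in>H_space F \<Theta>.
        (\<lambda>\<omega>. X \<omega> + Y \<omega>) \<in> H_space F \<Theta> \<and>
        \<not> (\<E> X = \<infinity> \<and> \<E> Y = -\<infinity>) \<and> \<not> (\<E> X = -\<infinity> \<and> \<E> Y = \<infinity>) \<longrightarrow>
        \<E> (\<lambda>\<omega>. X \<omega> + Y \<omega>) \<le> \<E> X + \<E> Y) \<and>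
     (\<forall>Xs X. (\<forall>n::nat. Xs n \<in> H_space F \<Theta>) \<and> X \<in> H_space F \<Theta> \<and>
        (\<forall>\<omega>\<in>space F. (\<forall>n. Xs n \<omega> \<ge> 0) \<and> incseq (\<lambda>n. Xs n \<omega>) \<and> (\<lambda>n. Xs n \<omega>) \<longlonglongrightarrow> X \<omega>) \<longrightarrow>
        incseq (\<lambda>n. \<E> (Xs n)) \<and> (\<lambda>n. \<E> (Xs n)) \<longlonglongrightarrow> \<E> X)"

definition consistent_expectation ::
  "'a measure \<Rightarrow> 'a measure \<Rightarrow> 'a measure set \<Rightarrow> (('a \<Rightarrow> real) \<Rightarrow> ereal) \<Rightarrow>
   (('a \<Rightarrow> real) \<Rightarrow> ('a \<Rightarrow> real)) \<Rightarrow> bool" where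
  "consistent_expectation F G \<Theta> \<E> \<E>\<^sub>G \<longleftrightarrow>
     (\<forall>X\<in>L1_space F \<Theta> F. \<E>\<^sub>G X \<in> L1_space F \<Theta> G) \<and>
     (\<forall>X\<in>L1_space F \<Theta> F. \<E> (\<E>\<^sub>G X) = \<E> X) \<and>
     (\<forall>Y\<in>L1_space F \<Theta> F. \<forall>A\<in>sets (qs_algebra G \<Theta>). quasi_surely F \<Theta>
        (\<lambda>\<omega>. \<E>\<^sub>G (\<lambda>\<omega>'. indicator A \<omega>' * Y \<omega>') \<omega> = indicator A \<omega> * \<E>\<^sub>G Y \<omega>)) \<and>
     (\<forall>X\<in>L1_space F \<Theta> F. \<forall>Y\<in>L1_space F \<Theta> F. (\<forall>\<omega>\<in>space F. X \<omega> \<ge> Y \<omega>) \<longrightarrow>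
        quasi_surely F \<Theta> (\<lambda>\<omega>. \<E>\<^sub>G X \<omega> \<ge> \<E>\<^sub>G Y \<omega>)) \<and>
     (\<forall>Y\<in>L1_space F \<Theta> G. quasi_surely F \<Theta> (\<lambda>\<omega>. \<E>\<^sub>G Y \<omega> = Y \<omega>)) \<and>
     (\<forall>X\<in>L1_space F \<Theta> F. \<forall>Y\<in>L1_space F \<Theta> G. quasi_surely F \<Theta>
        (\<lambda>\<omega>. \<E>\<^sub>G (\<lambda>\<omega>'. X \<omega>' + Y \<omega>') \<omega> = \<E>\<^sub>G X \<omega> + Y \<omega>)) \<and>
     (\<forall>X\<in>L1_space F \<Theta> F. \<forall>Y\<in>L1_space F \<Theta> F. quasi_surely F \<Theta>
        (\<lambda>\<omega>. \<E>\<^sub>G (\<lambda>\<omega>'. X \<omega>' + Y \<omega>') \<omega> \<le> \<E>\<^sub>G X \<omega> + \<E>\<^sub>G Y \<omega>)) \<and>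
     (\<forall>Y\<in>L1_space F \<Theta> F. \<forall>l\<in>borel_measurable (qs_algebra G \<Theta>).
        (\<lambda>\<omega>. l \<omega> * Y \<omega>) \<in> L1_space F \<Theta> F \<longrightarrow> quasi_surely F \<Theta>
        (\<lambda>\<omega>. \<E>\<^sub>G (\<lambda>\<omega>'. l \<omega>' * Y \<omega>') \<omega> =
             max (l \<omega>) 0 * \<E>\<^sub>G Y \<omega> + max (- l \<omega>) 0 * \<E>\<^sub>G (\<lambda>\<omega>'. - Y \<omega>') \<omega>))"

text \<open>The Hahn property on \<open>\<G>\<close>, with a chosen dominating family \<open>\<Phi>\<close> and chosen disjoint
  supports \<open>S \<phi>\<close>.\<close>

definition hahn_property_with ::
  "'a measure \<Rightarrow> 'a measure set \<Rightarrow> 'a measure set \<Rightarrow> ('a measure \<Rightarrow> 'a set) \<Rightarrow> bool" where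
  "hahn_property_with G \<Theta> \<Phi> S \<longleftrightarrow>
     (\<forall>\<phi>\<in>\<Phi>. prob_space \<phi> \<and> space \<phi> = space G \<and> sets \<phi> = sets G) \<and>
     (\<forall>N. polar G \<Phi> N \<longleftrightarrow> polar G \<Theta> N) \<and>
     (borel_measurable (qs_algebra G \<Theta>) :: ('a \<Rightarrow> real) set) = borel_measurable (qs_algebra G \<Phi>) \<and>
     (\<forall>\<phi>\<in>\<Phi>. S \<phi> \<in> sets (qs_algebra G \<Theta>) \<and> emeasure (qs_extension G \<Phi> \<phi>) (S \<phi>) = 1) \<and>
     disjoint_family_on S \<Phi>"

text \<open>\<open>Z\<close> is a version of the \<open>\<Theta>\<close>-essential supremum of the family \<open>\<X>\<close>.\<close>

definition is_qs_ess_sup ::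
  "'a measure \<Rightarrow> 'a measure \<Rightarrow> 'a measure set \<Rightarrow> ('a \<Rightarrow> ereal) set \<Rightarrow> ('a \<Rightarrow> ereal) \<Rightarrow> bool" where
  "is_qs_ess_sup F G \<Theta> \<X> Z \<longleftrightarrow>
     Z \<in> borel_measurable (qs_algebra G \<Theta>) \<and>
     (\<forall>X\<in>\<X>. quasi_surely F \<Theta> (\<lambda>\<omega>. Z \<omega> \<ge> X \<omega>)) \<and>
     (\<forall>Y\<in>borel_measurable (qs_algebra G \<Theta>).
        (\<forall>X\<in>\<X>. quasi_surely F \<Theta> (\<lambda>\<omega>. Y \<omega> \<ge> X \<omega>)) \<longrightarrow> quasi_surely F \<Theta> (\<lambda>\<omega>. Y \<omega> \<ge> Z \<omega>))"

text \<open>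
  The density of \<open>\<theta>\<close> with respect to \<open>\<phi>\<close> on \<open>S \<phi>\<close>, and \<open>0\<close> elsewhere.  Off \<open>S \<phi>\<close> the measure
  \<open>\<theta>\<close> need not be absolutely continuous with respect to \<open>\<phi>\<close>, and \<^const>\<open>RN_deriv\<close> is only
  meaningful under absolute continuity, so \<open>\<theta>\<close> is cut down to \<open>S \<phi>\<close> first.  As \<open>S \<phi>\<close> need only
  belong to \<open>\<G>\<^sup>\<Theta> = \<G>\<^sup>\<Phi>\<close>, both measures are extended to that sigma-algebra.
\<close>

definition hahn_density ::
  "'a measure \<Rightarrow> 'a measure set \<Rightarrow> 'a measure set \<Rightarrow> ('a measure \<Rightarrow> 'a set) \<Rightarrow>
   'a measure \<Rightarrow> 'a measure \<Rightarrow> 'a \<Rightarrow> ereal" where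
  "hahn_density G \<Theta> \<Phi> S \<theta> \<phi> \<omega> =
     enn2ereal (RN_deriv (qs_extension G \<Phi> \<phi>)
                  (density (qs_extension G \<Theta> \<theta>) (indicator (S \<phi>))) \<omega> * indicator (S \<phi>) \<omega>)"

text \<open>\<open>T\<close> is a version of the \<open>\<G>\<^sup>\<Theta>\<close>-measurable support of \<open>\<theta>\<close>.\<close>

definition is_qs_support ::
  "'a measure \<Rightarrow> 'a measure \<Rightarrow> 'a measure set \<Rightarrow> 'a measure set \<Rightarrow> ('a measure \<Rightarrow> 'a set) \<Rightarrow>
   'a measure \<Rightarrow> 'a set \<Rightarrow> bool" where
  "is_qs_support F G \<Theta> \<Phi> S \<theta> T \<longleftrightarrow>
     (\<exists>L. is_qs_ess_sup F G \<Theta> (hahn_density G \<Theta> \<Phi> S \<theta> ` \<Phi>) L \<and> T = {\<omega> \<in> space F. L \<omega> > 0})"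

definition is_cond_exp_version ::
  "'a measure \<Rightarrow> 'a measure \<Rightarrow> 'a measure set \<Rightarrow> 'a measure \<Rightarrow> ('a \<Rightarrow> real) \<Rightarrow> ('a \<Rightarrow> real) \<Rightarrow> bool" where
  "is_cond_exp_version F G \<Theta> \<theta> X Y \<longleftrightarrow>
     Y \<in> borel_measurable (qs_algebra G \<Theta>) \<and>
     (AE \<omega> in qs_extension F \<Theta> \<theta>. Y \<omega> = real_cond_exp (qs_extension F \<Theta> \<theta>) G X \<omega>)"

text \<open>The quasi-sure conditional expectation obtained from a support \<open>T\<close> of \<open>\<theta>\<close> and a version
  \<open>Y\<close> of the classical conditional expectation under \<open>\<theta>\<close>.\<close>

definition qs_cond_exp :: "'a set \<Rightarrow> ('a \<Rightarrow> real) \<Rightarrow> 'a \<Rightarrow> ereal" where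
  "qs_cond_exp T Y \<omega> = (if \<omega> \<in> T then ereal (Y \<omega>) else -\<infinity>)"

end

theory Submission
  imports Defs
begin

text \<open>
  The essential supremum is realised by \<open>\<E>\<^sub>G X\<close> itself. The argument rests on one identity
  (\<open>SUP_integral_centred\<close>): for \<open>A \<in> \<G>\<^sup>\<Theta>\<close> and a constant \<open>c\<close>, regularity and cash
  additivity give \<open>\<E>\<^sub>G (I\<^sub>A (X - \<E>\<^sub>G X + c)) = c I\<^sub>A\<close> quasi-surely, so recursivity and the
  representation yield
  \<open>sup\<^sub>\<theta> E\<^sub>\<theta>[I\<^sub>A (X - \<E>\<^sub>G X + c)] = sup\<^sub>\<theta> c \<theta>(A)\<close>. Under each \<open>\<theta>\<close>, \<open>X\<close> may be replaced on the
  left by a version \<open>Y \<theta>\<close> of the classical conditional expectation.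

  Upper bound. With \<open>c = 0\<close> and \<open>A = {\<E>\<^sub>G X < Y \<theta>}\<close> the identity shows
  \<open>Y \<theta> \<le> \<E>\<^sub>G X\<close> almost surely under \<open>\<theta>\<close> (\<open>cond_exp_le_consistent_AE\<close>). The Hahn property turns
  this into a quasi-sure inequality on the support of \<open>\<theta>\<close>, since a \<open>\<theta>\<close>-null subset of the
  support is polar (\<open>support_null_imp_qs\<close>); off the support the conditional expectation is \<open>-\<infinity>\<close>.

  Minimality. If \<open>W\<close> dominates all \<open>Y \<theta>\<close> on their supports, which have full \<open>\<theta>\<close>-measure, then
  for \<open>c > 0\<close> and \<open>A = {W \<le> \<E>\<^sub>G X - c}\<close> the left-hand side of the identity is nonpositive; hence
  \<open>\<theta>(A) = 0\<close> for all \<open>\<theta>\<close>, and \<open>c\<close> may be sent to \<open>0\<close> along \<open>1 / n\<close>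
  (\<open>consistent_le_upper_bound\<close>).

  Quasi-sure statements are handled throughout as statements that hold almost surely under every
  \<open>\<theta>\<close> (\<open>quasi_surely_iff_AE\<close>).
\<close>

section \<open>Completions and quasi-sure statements\<close>

lemma restr_to_subalg_sets_eq:
  assumes "sets A = sets M"
  shows "restr_to_subalg M A = M"
proof -
  have "subalgebra M A"
    using assms sets_eq_imp_space_eq[OF assms] by (simp add: subalgebra_def)
  then show ?thesis
    using assms by (intro measure_eqI) (auto simp: sets_restr_to_subalg emeasure_restr_to_subalg)
qed

lemma prob_space_qs_extension:
  assumes sub: "\<And>\<psi>. \<psi> \<in> \<Psi> \<Longrightarrow> subalgebra \<psi> A" and \<psi>: "\<psi> \<in> \<Psi>" and "prob_space \<psi>"
  shows "prob_space (qs_extension A \<Psi> \<psi>)"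
  unfolding qs_extension_def
  by (intro prob_space_restr_to_subalg subalgebra_completion_qs_algebra
      prob_space.prob_space_completion sub \<psi> assms(3))

lemma sets_subset_qs_algebra:
  assumes sub: "\<And>\<psi>. \<psi> \<in> \<Psi> \<Longrightarrow> subalgebra \<psi> A"
  shows "sets A \<subseteq> sets (qs_algebra A \<Psi>)"
proof
  fix N assume N: "N \<in> sets A"
  have "N \<in> sets (completion (restr_to_subalg \<psi> A))" if "\<psi> \<in> \<Psi>" for \<psi>
    by (rule sets_completionI_sets) (simp add: sets_restr_to_subalg[OF sub[OF that]] N)
  then show "N \<in> sets (qs_algebra A \<Psi>)"
    using sets.sets_into_space[OF N] by (subst sets_qs_algebra[OF sub]) auto
qed

lemma AE_qs_extension_iff:
  assumes sub: "\<And>\<psi>. \<psi> \<in> \<Psi> \<Longrightarrow> subalgebra \<psi> A" and \<psi>: "\<psi> \<in> \<Psi>"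
  shows "(AE \<omega> in qs_extension A \<Psi> \<psi>. P \<omega>) \<longleftrightarrow> (AE \<omega> in restr_to_subalg \<psi> A. P \<omega>)"
proof
  assume "AE \<omega> in qs_extension A \<Psi> \<psi>. P \<omega>"
  then have "AE \<omega> in completion (restr_to_subalg \<psi> A). P \<omega>"
    unfolding qs_extension_def
    by (rule AE_restr_to_subalg[rotated]) (rule subalgebra_completion_qs_algebra[OF sub \<psi>])
  then show "AE \<omega> in restr_to_subalg \<psi> A. P \<omega>"
    by (simp only: AE_completion_iff)
next
  assume "AE \<omega> in restr_to_subalg \<psi> A. P \<omega>"
  then obtain N where N: "N \<in> null_sets (restr_to_subalg \<psi> A)"
    and P: "{\<omega> \<in> space (restr_to_subalg \<psi> A). \<not> P \<omega>} \<subseteq> N"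
    unfolding eventually_ae_filter by blast
  have "N \<in> sets A"
    using N by (auto simp: null_sets_def sets_restr_to_subalg[OF sub[OF \<psi>]])
  then have Nq: "N \<in> sets (qs_algebra A \<Psi>)"
    using sets_subset_qs_algebra[OF sub] by blast
  have "N \<in> null_sets (qs_extension A \<Psi> \<psi>)"
    unfolding qs_extension_def
    by (subst null_sets_restr_to_subalg[OF subalgebra_completion_qs_algebra[OF sub \<psi>]])
      (use Nq null_sets_completionI[OF N] in auto)
  moreover have "space (qs_extension A \<Psi> \<psi>) = space (restr_to_subalg \<psi> A)"
    by (simp add: qs_extension_def space_restr_to_subalg)
  ultimately show "AE \<omega> in qs_extension A \<Psi> \<psi>. P \<omega>"
    using P unfolding eventually_ae_filter by auto
qed

text \<open>Measurability of a polar set is automatic: a set that is null in each completion lies in each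
  completion, hence in their intersection.\<close>

lemma polar_iff_AE:
  assumes sub: "\<And>\<psi>. \<psi> \<in> \<Psi> \<Longrightarrow> subalgebra \<psi> A"
  shows "polar A \<Psi> N \<longleftrightarrow> N \<subseteq> space A \<and> (\<forall>\<psi>\<in>\<Psi>. AE \<omega> in restr_to_subalg \<psi> A. \<omega> \<notin> N)"
proof
  assume p: "polar A \<Psi> N"
  then have N: "N \<in> sets (qs_algebra A \<Psi>)" by (simp add: polar_def)
  have "AE \<omega> in restr_to_subalg \<psi> A. \<omega> \<notin> N" if \<psi>: "\<psi> \<in> \<Psi>" for \<psi>
  proof -
    have "N \<in> null_sets (qs_extension A \<Psi> \<psi>)"
      using p N \<psi> by (auto simp: polar_def null_sets_def sets_qs_extension[OF sub \<psi>])
    from AE_not_in[OF this] show ?thesis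
      by (simp only: AE_qs_extension_iff[OF sub \<psi>])
  qed
  then show "N \<subseteq> space A \<and> (\<forall>\<psi>\<in>\<Psi>. AE \<omega> in restr_to_subalg \<psi> A. \<omega> \<notin> N)"
    using sets.sets_into_space[OF N] by auto
next
  assume a: "N \<subseteq> space A \<and> (\<forall>\<psi>\<in>\<Psi>. AE \<omega> in restr_to_subalg \<psi> A. \<omega> \<notin> N)"
  have "N \<in> sets (completion (restr_to_subalg \<psi> A))" if \<psi>: "\<psi> \<in> \<Psi>" for \<psi>
  proof -
    from a \<psi> obtain N' where N': "N' \<in> null_sets (restr_to_subalg \<psi> A)"
      and s: "{\<omega> \<in> space (restr_to_subalg \<psi> A). \<not> \<omega> \<notin> N} \<subseteq> N'"
      unfolding eventually_ae_filter by blast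
    have "space (restr_to_subalg \<psi> A) = space A"
      using sub[OF \<psi>] by (simp add: space_restr_to_subalg subalgebra_def)
    with s a have "N \<subseteq> N'" by auto
    then show ?thesis by (rule null_sets_completion[OF N'])
  qed
  with a have N: "N \<in> sets (qs_algebra A \<Psi>)"
    by (subst sets_qs_algebra[OF sub]) auto
  have "emeasure (qs_extension A \<Psi> \<psi>) N = 0" if \<psi>: "\<psi> \<in> \<Psi>" for \<psi>
  proof -
    have "AE \<omega> in qs_extension A \<Psi> \<psi>. \<omega> \<notin> N"
      using a \<psi> by (simp only: AE_qs_extension_iff[OF sub \<psi>])
    moreover have "N \<in> sets (qs_extension A \<Psi> \<psi>)"
      by (subst sets_qs_extension[OF sub \<psi>]) (auto intro: N)
    ultimately show ?thesis
      by (metis AE_iff_null_sets null_setsD1)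
  qed
  with N show "polar A \<Psi> N" by (simp add: polar_def)
qed

text \<open>The common setting: a family \<open>\<Theta>\<close> of probability measures on \<open>F\<close>, and a sub-sigma-algebra
  \<open>G\<close>. The extension of \<open>\<theta>\<close> to \<open>\<F>\<^sup>\<Theta>\<close>, under which all expectations are taken, is written
  \<open>ext \<theta>\<close>.\<close>

locale prob_family =
  fixes F G :: "'a measure" and \<Theta> :: "'a measure set"
  assumes sub: "subalgebra F G"
    and Theta: "\<theta> \<in> \<Theta> \<Longrightarrow> prob_space \<theta> \<and> space \<theta> = space F \<and> sets \<theta> = sets F"
begin

lemma subF: "\<theta> \<in> \<Theta> \<Longrightarrow> subalgebra \<theta> F"
  using Theta by (auto simp: subalgebra_def)

lemma subG: "\<theta> \<in> \<Theta> \<Longrightarrow> subalgebra \<theta> G"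
  using Theta sub by (auto simp: subalgebra_def)

lemma space_G [simp]: "space G = space F"
  using sub by (simp add: subalgebra_def)

lemma restrF: "\<theta> \<in> \<Theta> \<Longrightarrow> restr_to_subalg \<theta> F = \<theta>"
  using Theta by (intro restr_to_subalg_sets_eq) auto

abbreviation ext :: "'a measure \<Rightarrow> 'a measure" where
  "ext \<theta> \<equiv> qs_extension F \<Theta> \<theta>"

lemma space_ext [simp]: "\<theta> \<in> \<Theta> \<Longrightarrow> space (ext \<theta>) = space F"
  using Theta by (simp add: qs_extension_def space_restr_to_subalg)

lemma sets_ext [measurable_cong]: "\<theta> \<in> \<Theta> \<Longrightarrow> sets (ext \<theta>) = sets (qs_algebra F \<Theta>)"
  using subF by (rule sets_qs_extension)

lemma prob_space_ext: "\<theta> \<in> \<Theta> \<Longrightarrow> prob_space (ext \<theta>)"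
  by (rule prob_space_qs_extension) (auto simp: Theta subF)

lemma AE_ext_iff: "\<theta> \<in> \<Theta> \<Longrightarrow> (AE \<omega> in ext \<theta>. P \<omega>) \<longleftrightarrow> (AE \<omega> in \<theta>. P \<omega>)"
  by (subst AE_qs_extension_iff) (simp_all only: subF restrF)

lemma AE_qs_extension_G_iff:
  "\<theta> \<in> \<Theta> \<Longrightarrow> (AE \<omega> in qs_extension G \<Theta> \<theta>. P \<omega>) \<longleftrightarrow> (AE \<omega> in restr_to_subalg \<theta> G. P \<omega>)"
  by (rule AE_qs_extension_iff) (rule subG)

text \<open>A property holds quasi-surely iff it holds almost surely under every measure; no measurability
  is needed, and the exceptional sets may depend on the measure.\<close>

lemma quasi_surely_iff_AE: "quasi_surely F \<Theta> P \<longleftrightarrow> (\<forall>\<theta>\<in>\<Theta>. AE \<omega> in \<theta>. P \<omega>)"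
proof
  assume "quasi_surely F \<Theta> P"
  then obtain N where p: "polar F \<Theta> N" and s: "{\<omega> \<in> space F. \<not> P \<omega>} \<subseteq> N"
    by (auto simp: quasi_surely_def)
  show "\<forall>\<theta>\<in>\<Theta>. AE \<omega> in \<theta>. P \<omega>"
  proof
    fix \<theta> assume \<theta>: "\<theta> \<in> \<Theta>"
    have "AE \<omega> in \<theta>. \<omega> \<notin> N"
      using p \<theta> restrF[OF \<theta>] by (metis polar_iff_AE[OF subF])
    then show "AE \<omega> in \<theta>. P \<omega>"
      by (rule AE_mp) (use s Theta[OF \<theta>] in auto)
  qed
next
  assume a: "\<forall>\<theta>\<in>\<Theta>. AE \<omega> in \<theta>. P \<omega>"
  have "polar F \<Theta> {\<omega> \<in> space F. \<not> P \<omega>}"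
  proof (subst polar_iff_AE[OF subF], assumption, intro conjI ballI)
    show "AE \<omega> in restr_to_subalg \<theta> F. \<omega> \<notin> {\<omega> \<in> space F. \<not> P \<omega>}" if "\<theta> \<in> \<Theta>" for \<theta>
      using a that by (auto simp: restrF elim!: eventually_mono)
  qed auto
  then show "quasi_surely F \<Theta> P"
    by (auto simp: quasi_surely_def)
qed

lemma quasi_surely_mono:
  assumes "quasi_surely F \<Theta> P" "\<And>\<omega>. \<omega> \<in> space F \<Longrightarrow> P \<omega> \<Longrightarrow> Q \<omega>"
  shows "quasi_surely F \<Theta> Q"
  using assms unfolding quasi_surely_def by blast

text \<open>A set of \<open>\<G>\<^sup>\<Theta>\<close> agrees, up to a null set depending on \<open>\<theta>\<close>, with a set of \<open>\<G>\<close>.\<close>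

lemma qs_algebra_G_modification:
  assumes A: "A \<in> sets (qs_algebra G \<Theta>)" and \<theta>: "\<theta> \<in> \<Theta>"
  obtains A' where "A' \<in> sets G" "AE \<omega> in restr_to_subalg \<theta> G. \<omega> \<in> A \<longleftrightarrow> \<omega> \<in> A'"
    "AE \<omega> in \<theta>. \<omega> \<in> A \<longleftrightarrow> \<omega> \<in> A'"
proof -
  have "A \<in> sets (completion (restr_to_subalg \<theta> G))"
    using A \<theta> by (subst (asm) sets_qs_algebra[OF subG]) auto
  then obtain B N N' where B: "A = B \<union> N" "N \<subseteq> N'"
    "N' \<in> null_sets (restr_to_subalg \<theta> G)" "B \<in> sets (restr_to_subalg \<theta> G)"
    by (rule sets_completionE)
  have AE: "AE \<omega> in restr_to_subalg \<theta> G. \<omega> \<in> A \<longleftrightarrow> \<omega> \<in> B"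
    using AE_not_in[OF B(3)] by eventually_elim (use B in auto)
  show ?thesis
    using that[of B] AE AE_restr_to_subalg[OF subG[OF \<theta>] AE] B(4)
    by (simp add: sets_restr_to_subalg[OF subG[OF \<theta>]])
qed

lemma subalgebra_qs_algebra: "subalgebra (qs_algebra F \<Theta>) (qs_algebra G \<Theta>)"
  unfolding subalgebra_def
proof (intro conjI subsetI)
  fix A assume A: "A \<in> sets (qs_algebra G \<Theta>)"
  have "A \<in> sets (completion (restr_to_subalg \<theta> F))" if \<theta>: "\<theta> \<in> \<Theta>" for \<theta>
  proof -
    have "A \<in> sets (completion (restr_to_subalg \<theta> G))"
      using A \<theta> by (subst (asm) sets_qs_algebra[OF subG]) auto
    then obtain B N N' where B: "A = B \<union> N" "N \<subseteq> N'"
      "N' \<in> null_sets (restr_to_subalg \<theta> G)" "B \<in> sets (restr_to_subalg \<theta> G)"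
      by (rule sets_completionE)
    have "B \<in> sets F"
      using B(4) sub sets_restr_to_subalg[OF subG[OF \<theta>]] by (auto simp: subalgebra_def)
    moreover have "N' \<in> null_sets \<theta>"
      using B(3) by (simp add: null_sets_restr_to_subalg[OF subG[OF \<theta>]])
    ultimately show ?thesis
      using B(1,2) Theta[OF \<theta>] unfolding restrF[OF \<theta>]
      by (intro sets_completionI[of A B N N']) auto
  qed
  then show "A \<in> sets (qs_algebra F \<Theta>)"
    using sets.sets_into_space[OF A] by (subst sets_qs_algebra[OF subF]) auto
qed simp

lemma measurable_qs_G_F:
  "f \<in> borel_measurable (qs_algebra G \<Theta>) \<Longrightarrow> f \<in> borel_measurable (qs_algebra F \<Theta>)"
  by (rule measurable_from_subalg[OF subalgebra_qs_algebra])

lemma AE_restr_not_in_iff: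
  assumes A: "A \<in> sets (qs_algebra G \<Theta>)" and \<theta>: "\<theta> \<in> \<Theta>"
  shows "(AE \<omega> in restr_to_subalg \<theta> G. \<omega> \<notin> A) \<longleftrightarrow> (AE \<omega> in \<theta>. \<omega> \<notin> A)"
proof
  show "AE \<omega> in \<theta>. \<omega> \<notin> A" if "AE \<omega> in restr_to_subalg \<theta> G. \<omega> \<notin> A"
    by (rule AE_restr_to_subalg[OF subG[OF \<theta>] that])
  assume 1: "AE \<omega> in \<theta>. \<omega> \<notin> A"
  obtain A' where A': "A' \<in> sets G" "AE \<omega> in restr_to_subalg \<theta> G. \<omega> \<in> A \<longleftrightarrow> \<omega> \<in> A'"
    "AE \<omega> in \<theta>. \<omega> \<in> A \<longleftrightarrow> \<omega> \<in> A'"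
    by (rule qs_algebra_G_modification[OF A \<theta>])
  have "AE \<omega> in \<theta>. \<omega> \<notin> A'"
    using 1 A'(3) by eventually_elim auto
  then have "AE \<omega> in restr_to_subalg \<theta> G. \<omega> \<notin> A'"
    by (rule AE_restr_to_subalg2[OF subG[OF \<theta>]]) (use A'(1) in measurable)
  with A'(2) show "AE \<omega> in restr_to_subalg \<theta> G. \<omega> \<notin> A"
    by eventually_elim auto
qed

lemma polar_G_iff_AE:
  assumes "A \<in> sets (qs_algebra G \<Theta>)"
  shows "polar G \<Theta> A \<longleftrightarrow> (\<forall>\<theta>\<in>\<Theta>. AE \<omega> in \<theta>. \<omega> \<notin> A)"
  using sets.sets_into_space[OF assms]
  by (auto simp: polar_iff_AE[OF subG] AE_restr_not_in_iff[OF assms])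

section \<open>Expectations of integrable functions\<close>

lemma integrable_L1:
  assumes "X \<in> L1_space F \<Theta> F" and \<theta>: "\<theta> \<in> \<Theta>"
  shows "integrable (ext \<theta>) X"
proof (rule integrableI_bounded)
  show "X \<in> borel_measurable (ext \<theta>)"
    using assms by (simp add: L1_space_def cong: measurable_cong_sets[OF sets_ext[OF \<theta>] refl])
  have "(\<integral>\<^sup>+\<omega>. ennreal \<bar>X \<omega>\<bar> \<partial>ext \<theta>) \<le> (SUP \<theta>\<in>\<Theta>. \<integral>\<^sup>+\<omega>. ennreal \<bar>X \<omega>\<bar> \<partial>ext \<theta>)"
    using \<theta> by (rule SUP_upper)
  also have "\<dots> < \<infinity>" using assms by (simp add: L1_space_def)
  finally show "(\<integral>\<^sup>+\<omega>. ennreal (norm (X \<omega>)) \<partial>ext \<theta>) < \<infinity>" by simp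
qed

lemma L1_G_subset_F: "X \<in> L1_space F \<Theta> G \<Longrightarrow> X \<in> L1_space F \<Theta> F"
  by (auto simp: L1_space_def measurable_qs_G_F)

lemma L1_subset_H: "X \<in> L1_space F \<Theta> F \<Longrightarrow> X \<in> H_space F \<Theta>"
proof -
  assume X: "X \<in> L1_space F \<Theta> F"
  have "(\<integral>\<^sup>+\<omega>. ennreal (X \<omega>) \<partial>ext \<theta>) < \<infinity>" if "\<theta> \<in> \<Theta>" for \<theta>
    using integrable_L1[OF X that] by (simp add: real_integrable_def less_top)
  then show ?thesis
    using X by (auto simp: H_space_def L1_space_def)
qed

lemma L1_const: "(\<lambda>_. c) \<in> L1_space F \<Theta> A"
proof -
  have "(SUP \<theta>\<in>\<Theta>. \<integral>\<^sup>+\<omega>. ennreal \<bar>c\<bar> \<partial>ext \<theta>) \<le> ennreal \<bar>c\<bar>"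
    by (intro SUP_least) (use prob_space.emeasure_space_1[OF prob_space_ext] in simp)
  also have "\<dots> < \<infinity>" by simp
  finally show ?thesis by (simp add: L1_space_def)
qed

lemma L1_add:
  assumes A: "A = F \<or> A = G" and "X \<in> L1_space F \<Theta> A" "Y \<in> L1_space F \<Theta> A"
  shows "(\<lambda>\<omega>. X \<omega> + Y \<omega>) \<in> L1_space F \<Theta> A"
proof -
  have m: "X \<in> borel_measurable (qs_algebra F \<Theta>)" "Y \<in> borel_measurable (qs_algebra F \<Theta>)"
    using assms by (auto simp: L1_space_def intro: measurable_qs_G_F)
  have "(SUP \<theta>\<in>\<Theta>. \<integral>\<^sup>+\<omega>. ennreal \<bar>X \<omega> + Y \<omega>\<bar> \<partial>ext \<theta>)
    \<le> (SUP \<theta>\<in>\<Theta>. \<integral>\<^sup>+\<omega>. ennreal \<bar>X \<omega>\<bar> \<partial>ext \<theta>) + (SUP \<theta>\<in>\<Theta>. \<integral>\<^sup>+\<omega>. ennreal \<bar>Y \<omega>\<bar> \<partial>ext \<theta>)"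
  proof (intro SUP_least)
    fix \<theta> assume \<theta>: "\<theta> \<in> \<Theta>"
    have [measurable]: "X \<in> borel_measurable (ext \<theta>)" "Y \<in> borel_measurable (ext \<theta>)"
      using m by (auto cong: measurable_cong_sets[OF sets_ext[OF \<theta>] refl])
    have "(\<integral>\<^sup>+\<omega>. ennreal \<bar>X \<omega> + Y \<omega>\<bar> \<partial>ext \<theta>) \<le> (\<integral>\<^sup>+\<omega>. ennreal \<bar>X \<omega>\<bar> + ennreal \<bar>Y \<omega>\<bar> \<partial>ext \<theta>)"
      by (intro nn_integral_mono) (auto simp flip: ennreal_plus intro!: ennreal_leI)
    also have "\<dots> = (\<integral>\<^sup>+\<omega>. ennreal \<bar>X \<omega>\<bar> \<partial>ext \<theta>) + (\<integral>\<^sup>+\<omega>. ennreal \<bar>Y \<omega>\<bar> \<partial>ext \<theta>)"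
      by (rule nn_integral_add) auto
    also have "\<dots> \<le> (SUP \<theta>\<in>\<Theta>. \<integral>\<^sup>+\<omega>. ennreal \<bar>X \<omega>\<bar> \<partial>ext \<theta>) + (SUP \<theta>\<in>\<Theta>. \<integral>\<^sup>+\<omega>. ennreal \<bar>Y \<omega>\<bar> \<partial>ext \<theta>)"
      using \<theta> by (intro add_mono SUP_upper)
    finally show "(\<integral>\<^sup>+\<omega>. ennreal \<bar>X \<omega> + Y \<omega>\<bar> \<partial>ext \<theta>) \<le> \<dots>" .
  qed
  also have "\<dots> < \<infinity>" using assms by (auto simp: L1_space_def)
  finally show ?thesis using assms by (auto simp: L1_space_def)
qed

lemma L1_dominated:
  assumes "X \<in> L1_space F \<Theta> A" "Y \<in> borel_measurable (qs_algebra A \<Theta>)" "\<And>\<omega>. \<bar>Y \<omega>\<bar> \<le> \<bar>X \<omega>\<bar>"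
  shows "Y \<in> L1_space F \<Theta> A"
proof -
  have "(SUP \<theta>\<in>\<Theta>. \<integral>\<^sup>+\<omega>. ennreal \<bar>Y \<omega>\<bar> \<partial>ext \<theta>) \<le> (SUP \<theta>\<in>\<Theta>. \<integral>\<^sup>+\<omega>. ennreal \<bar>X \<omega>\<bar> \<partial>ext \<theta>)"
    by (intro SUP_mono' nn_integral_mono ennreal_leI assms)
  also have "\<dots> < \<infinity>" using assms by (auto simp: L1_space_def)
  finally show ?thesis using assms by (auto simp: L1_space_def)
qed

lemma ext_expectation_integrable:
  assumes "integrable M X"
  shows "ext_expectation M X = ereal (\<integral>\<omega>. X \<omega> \<partial>M)"
proof -
  have "enn2ereal x = ereal (enn2real x)" if "x \<noteq> \<infinity>" for x
    using that by (cases x) (auto simp: enn2ereal_ennreal)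
  then show ?thesis
    using assms unfolding ext_expectation_def real_lebesgue_integral_def[OF assms]
    by (simp add: real_integrable_def)
qed

lemma represents_L1:
  assumes "represents F \<Theta> \<E>" and X: "X \<in> L1_space F \<Theta> F"
  shows "\<E> X = (SUP \<theta>\<in>\<Theta>. ereal (\<integral>\<omega>. X \<omega> \<partial>ext \<theta>))"
proof -
  have "\<E> X = (SUP \<theta>\<in>\<Theta>. ext_expectation (ext \<theta>) X)"
    using assms L1_subset_H[OF X] by (simp add: represents_def)
  also have "\<dots> = (SUP \<theta>\<in>\<Theta>. ereal (\<integral>\<omega>. X \<omega> \<partial>ext \<theta>))"
    by (intro SUP_cong refl ext_expectation_integrable integrable_L1[OF X])
  finally show ?thesis .
qed

section \<open>The conditional map and classical conditional expectations\<close>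

text \<open>The identity that carries both halves of the proof. By regularity and cash additivity the
  conditional map sends \<open>I\<^sub>A (X - \<E>\<^sub>G X + c)\<close> to \<open>c I\<^sub>A\<close> up to a polar set;
  recursivity then equates the sublinear expectations of the two.\<close>

lemma SUP_integral_centred:
  assumes cons: "consistent_expectation F G \<Theta> \<E> \<E>\<^sub>G" and repr: "represents F \<Theta> \<E>"
    and X: "X \<in> L1_space F \<Theta> F" and A: "A \<in> sets (qs_algebra G \<Theta>)"
  shows "(SUP \<theta>\<in>\<Theta>. ereal (\<integral>\<omega>. indicator A \<omega> * (X \<omega> - \<E>\<^sub>G X \<omega> + c) \<partial>ext \<theta>))
       = (SUP \<theta>\<in>\<Theta>. ereal (c * measure (ext \<theta>) A))"
proof -
  have L1G: "\<And>Z. Z \<in> L1_space F \<Theta> F \<Longrightarrow> \<E>\<^sub>G Z \<in> L1_space F \<Theta> G"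
    and rec: "\<And>Z. Z \<in> L1_space F \<Theta> F \<Longrightarrow> \<E> (\<E>\<^sub>G Z) = \<E> Z"
    and reg: "quasi_surely F \<Theta>
        (\<lambda>\<omega>. \<E>\<^sub>G (\<lambda>\<omega>'. indicator A \<omega>' * X \<omega>') \<omega> = indicator A \<omega> * \<E>\<^sub>G X \<omega>)"
    and cash: "\<And>Z Y. Z \<in> L1_space F \<Theta> F \<Longrightarrow> Y \<in> L1_space F \<Theta> G \<Longrightarrow>
        quasi_surely F \<Theta> (\<lambda>\<omega>. \<E>\<^sub>G (\<lambda>\<omega>'. Z \<omega>' + Y \<omega>') \<omega> = \<E>\<^sub>G Z \<omega> + Y \<omega>)"
    using cons X A unfolding consistent_expectation_def by blast+
  have EX [measurable]: "\<E>\<^sub>G X \<in> borel_measurable (qs_algebra G \<Theta>)"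
    using L1G[OF X] by (simp add: L1_space_def)
  have [measurable]: "X \<in> borel_measurable (qs_algebra F \<Theta>)"
    using X by (simp add: L1_space_def)
  have AF: "A \<in> sets (qs_algebra F \<Theta>)"
    using A subalgebra_qs_algebra by (auto simp: subalgebra_def)
  \<comment> \<open>Regularity evaluates \<open>\<E>\<^sub>G U\<close>; the \<open>\<G>\<^sup>\<Theta>\<close>-measurable \<open>R\<close> is pulled out by cash additivity.\<close>
  define U where "U = (\<lambda>\<omega>. indicator A \<omega> * X \<omega>)"
  define R where "R = (\<lambda>\<omega>. indicator A \<omega> * (c - \<E>\<^sub>G X \<omega>))"
  have U: "U \<in> L1_space F \<Theta> F"
    unfolding U_def using AF
    by (intro L1_dominated[OF X]) (auto simp: indicator_def)
  have "(\<lambda>\<omega>. - \<E>\<^sub>G X \<omega>) \<in> L1_space F \<Theta> G"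
    by (rule L1_dominated[OF L1G[OF X]]) auto
  from L1_add[OF _ L1_const this] have "(\<lambda>\<omega>. c + - \<E>\<^sub>G X \<omega>) \<in> L1_space F \<Theta> G" by simp
  then have R: "R \<in> L1_space F \<Theta> G"
    unfolding R_def using A by (rule_tac L1_dominated) (auto simp: indicator_def)
  have UR: "(\<lambda>\<omega>. U \<omega> + R \<omega>) \<in> L1_space F \<Theta> F"
    using U L1_G_subset_F[OF R] by (intro L1_add) auto
  have eq: "quasi_surely F \<Theta> (\<lambda>\<omega>. \<E>\<^sub>G (\<lambda>\<omega>. U \<omega> + R \<omega>) \<omega> = c * indicator A \<omega>)"
    unfolding quasi_surely_iff_AE
  proof
    fix \<theta> assume \<theta>: "\<theta> \<in> \<Theta>"
    have "AE \<omega> in \<theta>. \<E>\<^sub>G U \<omega> = indicator A \<omega> * \<E>\<^sub>G X \<omega>"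
      using reg \<theta> by (simp add: quasi_surely_iff_AE U_def)
    moreover have "AE \<omega> in \<theta>. \<E>\<^sub>G (\<lambda>\<omega>. U \<omega> + R \<omega>) \<omega> = \<E>\<^sub>G U \<omega> + R \<omega>"
      using cash[OF U R] \<theta> by (simp add: quasi_surely_iff_AE)
    ultimately show "AE \<omega> in \<theta>. \<E>\<^sub>G (\<lambda>\<omega>. U \<omega> + R \<omega>) \<omega> = c * indicator A \<omega>"
      by eventually_elim (simp add: R_def algebra_simps)
  qed
  have "(SUP \<theta>\<in>\<Theta>. ereal (\<integral>\<omega>. indicator A \<omega> * (X \<omega> - \<E>\<^sub>G X \<omega> + c) \<partial>ext \<theta>))
      = (SUP \<theta>\<in>\<Theta>. ereal (\<integral>\<omega>. U \<omega> + R \<omega> \<partial>ext \<theta>))"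
    by (simp add: U_def R_def algebra_simps)
  also have "\<dots> = \<E> (\<lambda>\<omega>. U \<omega> + R \<omega>)"
    using represents_L1[OF repr UR] by simp
  also have "\<dots> = \<E> (\<E>\<^sub>G (\<lambda>\<omega>. U \<omega> + R \<omega>))"
    using rec[OF UR] by simp
  also have "\<dots> = (SUP \<theta>\<in>\<Theta>. ereal (\<integral>\<omega>. \<E>\<^sub>G (\<lambda>\<omega>. U \<omega> + R \<omega>) \<omega> \<partial>ext \<theta>))"
    by (rule represents_L1[OF repr L1_G_subset_F[OF L1G[OF UR]]])
  also have "\<dots> = (SUP \<theta>\<in>\<Theta>. ereal (c * measure (ext \<theta>) A))"
  proof (intro SUP_cong refl arg_cong[where f = ereal])
    fix \<theta> assume \<theta>: "\<theta> \<in> \<Theta>"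
    interpret prob_space "ext \<theta>" by (rule prob_space_ext[OF \<theta>])
    have AM: "A \<in> sets (ext \<theta>)" using AF by (simp add: sets_ext[OF \<theta>])
    have AE: "AE \<omega> in ext \<theta>. \<E>\<^sub>G (\<lambda>\<omega>. U \<omega> + R \<omega>) \<omega> = c * indicator A \<omega>"
      using eq \<theta> by (simp add: quasi_surely_iff_AE AE_ext_iff[OF \<theta>])
    have "(\<integral>\<omega>. \<E>\<^sub>G (\<lambda>\<omega>. U \<omega> + R \<omega>) \<omega> \<partial>ext \<theta>) = (\<integral>\<omega>. c * indicator A \<omega> \<partial>ext \<theta>)"
    proof (rule integral_cong_AE[OF _ _ AE])
      show "\<E>\<^sub>G (\<lambda>\<omega>. U \<omega> + R \<omega>) \<in> borel_measurable (ext \<theta>)"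
        by (rule borel_measurable_integrable)
          (rule integrable_L1[OF L1_G_subset_F[OF L1G[OF UR]] \<theta>])
    qed (use AM in measurable)
    also have "\<dots> = c * measure (ext \<theta>) A"
      using AM sets.sets_into_space[OF AM] by (simp add: Int_absorb2)
    finally show "(\<integral>\<omega>. \<E>\<^sub>G (\<lambda>\<omega>. U \<omega> + R \<omega>) \<omega> \<partial>ext \<theta>) = c * measure (ext \<theta>) A" .
  qed
  finally show ?thesis .
qed

text \<open>Sets of \<open>\<G>\<^sup>\<Theta>\<close> differ from sets of \<open>\<G>\<close> only by \<open>\<theta>\<close>-null sets, so a version of the
  conditional expectation may be integrated over them.\<close>

lemma cond_exp_version_integral:
  assumes \<theta>: "\<theta> \<in> \<Theta>" and X: "integrable (ext \<theta>) X"
    and Y: "is_cond_exp_version F G \<Theta> \<theta> X Y" and A: "A \<in> sets (qs_algebra G \<Theta>)"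
  shows "integrable (ext \<theta>) Y"
    and "(\<integral>\<omega>. indicator A \<omega> * Y \<omega> \<partial>ext \<theta>) = (\<integral>\<omega>. indicator A \<omega> * X \<omega> \<partial>ext \<theta>)"
proof -
  interpret prob_space "ext \<theta>" by (rule prob_space_ext[OF \<theta>])
  have FE: "sets F \<subseteq> sets (ext \<theta>)"
    unfolding sets_ext[OF \<theta>] by (rule sets_subset_qs_algebra[OF subF])
  have "subalgebra (ext \<theta>) G"
    using FE sub \<theta> by (auto simp: subalgebra_def)
  then interpret finite_measure_subalgebra "ext \<theta>" G
    by unfold_locales
  have AM: "A \<in> sets (ext \<theta>)"
    using A subalgebra_qs_algebra by (auto simp: subalgebra_def sets_ext[OF \<theta>])
  have YM: "Y \<in> borel_measurable (ext \<theta>)"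
    using Y measurable_qs_G_F
    by (auto simp: is_cond_exp_version_def cong: measurable_cong_sets[OF sets_ext[OF \<theta>] refl])
  have Yeq: "AE \<omega> in ext \<theta>. Y \<omega> = real_cond_exp (ext \<theta>) G X \<omega>"
    using Y by (simp add: is_cond_exp_version_def)
  show "integrable (ext \<theta>) Y"
    using real_cond_exp_int(1)[OF X] YM Yeq by (subst integrable_cong_AE[OF _ _ Yeq]) auto
  obtain A' where A': "A' \<in> sets G" "AE \<omega> in \<theta>. \<omega> \<in> A \<longleftrightarrow> \<omega> \<in> A'"
    by (rule qs_algebra_G_modification[OF A \<theta>])
  have A'M: "A' \<in> sets (ext \<theta>)"
    using A'(1) \<open>subalgebra (ext \<theta>) G\<close> by (auto simp: subalgebra_def)
  have A'eq: "AE \<omega> in ext \<theta>. \<omega> \<in> A \<longleftrightarrow> \<omega> \<in> A'"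
    using A'(2) by (simp only: AE_ext_iff[OF \<theta>])
  have [measurable]: "X \<in> borel_measurable (ext \<theta>)" using X by auto
  note [measurable] = AM A'M YM
  have "(\<integral>\<omega>. indicator A \<omega> * Y \<omega> \<partial>ext \<theta>)
      = (\<integral>\<omega>. indicator A' \<omega> * real_cond_exp (ext \<theta>) G X \<omega> \<partial>ext \<theta>)"
    using Yeq A'eq by (intro integral_cong_AE) (auto simp: indicator_def)
  also have "\<dots> = (\<integral>\<omega>. indicator A' \<omega> * X \<omega> \<partial>ext \<theta>)"
    using real_cond_exp_intA[OF X A'(1)] by (simp add: set_lebesgue_integral_def)
  also have "\<dots> = (\<integral>\<omega>. indicator A \<omega> * X \<omega> \<partial>ext \<theta>)"
    using A'eq by (intro integral_cong_AE) (auto simp: indicator_def)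
  finally show "(\<integral>\<omega>. indicator A \<omega> * Y \<omega> \<partial>ext \<theta>) = (\<integral>\<omega>. indicator A \<omega> * X \<omega> \<partial>ext \<theta>)" .
qed

lemma integral_centred_cond_exp:
  assumes cons: "consistent_expectation F G \<Theta> \<E> \<E>\<^sub>G" and \<theta>: "\<theta> \<in> \<Theta>"
    and X: "X \<in> L1_space F \<Theta> F" and Y: "is_cond_exp_version F G \<Theta> \<theta> X Y"
    and A: "A \<in> sets (qs_algebra G \<Theta>)"
  shows "integrable (ext \<theta>) (\<lambda>\<omega>. indicator A \<omega> * (Y \<omega> - \<E>\<^sub>G X \<omega> + c))"
    and "(\<integral>\<omega>. indicator A \<omega> * (X \<omega> - \<E>\<^sub>G X \<omega> + c) \<partial>ext \<theta>)
       = (\<integral>\<omega>. indicator A \<omega> * (Y \<omega> - \<E>\<^sub>G X \<omega> + c) \<partial>ext \<theta>)"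
proof -
  interpret prob_space "ext \<theta>" by (rule prob_space_ext[OF \<theta>])
  have "\<E>\<^sub>G X \<in> L1_space F \<Theta> G"
    using cons X unfolding consistent_expectation_def by blast
  then have E: "integrable (ext \<theta>) (\<E>\<^sub>G X)"
    using integrable_L1[OF L1_G_subset_F \<theta>] by blast
  have AM: "A \<in> sets (ext \<theta>)"
    using A subalgebra_qs_algebra by (auto simp: subalgebra_def sets_ext[OF \<theta>])
  note XI = integrable_L1[OF X \<theta>]
  note Y' = cond_exp_version_integral[OF \<theta> XI Y A]
  have I: "integrable (ext \<theta>) (\<lambda>\<omega>. indicator A \<omega> * Z \<omega>)" if "integrable (ext \<theta>) Z" for Z :: "'a \<Rightarrow> real"
    using integrable_real_mult_indicator[OF AM that] by (simp add: mult.commute)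
  show "integrable (ext \<theta>) (\<lambda>\<omega>. indicator A \<omega> * (Y \<omega> - \<E>\<^sub>G X \<omega> + c))"
    by (intro I Bochner_Integration.integrable_add Bochner_Integration.integrable_diff Y'(1) E integrable_const)
  have split: "(\<integral>\<omega>. indicator A \<omega> * (Z \<omega> - \<E>\<^sub>G X \<omega> + c) \<partial>ext \<theta>)
      = (\<integral>\<omega>. indicator A \<omega> * Z \<omega> \<partial>ext \<theta>) + (\<integral>\<omega>. indicator A \<omega> * (c - \<E>\<^sub>G X \<omega>) \<partial>ext \<theta>)"
    if Z: "integrable (ext \<theta>) Z" for Z
  proof -
    have "integrable (ext \<theta>) (\<lambda>\<omega>. c - \<E>\<^sub>G X \<omega>)"
      by (intro Bochner_Integration.integrable_diff E integrable_const)
    from Bochner_Integration.integral_add[OF I[OF Z] I[OF this]] show ?thesis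
      by (simp add: algebra_simps)
  qed
  show "(\<integral>\<omega>. indicator A \<omega> * (X \<omega> - \<E>\<^sub>G X \<omega> + c) \<partial>ext \<theta>)
       = (\<integral>\<omega>. indicator A \<omega> * (Y \<omega> - \<E>\<^sub>G X \<omega> + c) \<partial>ext \<theta>)"
    by (simp only: split[OF XI] split[OF Y'(1)] Y'(2))
qed

lemma cond_exp_le_consistent_AE:
  assumes cons: "consistent_expectation F G \<Theta> \<E> \<E>\<^sub>G" and repr: "represents F \<Theta> \<E>"
    and X: "X \<in> L1_space F \<Theta> F" and \<theta>: "\<theta> \<in> \<Theta>" and Y: "is_cond_exp_version F G \<Theta> \<theta> X Y"
  shows "AE \<omega> in \<theta>. Y \<omega> \<le> \<E>\<^sub>G X \<omega>"
proof -
  interpret prob_space "ext \<theta>" by (rule prob_space_ext[OF \<theta>])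
  have [measurable]: "\<E>\<^sub>G X \<in> borel_measurable (qs_algebra G \<Theta>)"
    using cons X by (auto simp: consistent_expectation_def L1_space_def)
  have [measurable]: "Y \<in> borel_measurable (qs_algebra G \<Theta>)"
    using Y by (simp add: is_cond_exp_version_def)
  define A where "A = {\<omega> \<in> space (qs_algebra G \<Theta>). \<E>\<^sub>G X \<omega> < Y \<omega>}"
  have A: "A \<in> sets (qs_algebra G \<Theta>)" unfolding A_def by measurable
  define f where "f = (\<lambda>\<omega>. indicator A \<omega> * (Y \<omega> - \<E>\<^sub>G X \<omega> + 0))"
  have "ereal (\<integral>\<omega>. indicator A \<omega> * (X \<omega> - \<E>\<^sub>G X \<omega> + 0) \<partial>ext \<theta>)
      \<le> (SUP \<theta>\<in>\<Theta>. ereal (\<integral>\<omega>. indicator A \<omega> * (X \<omega> - \<E>\<^sub>G X \<omega> + 0) \<partial>ext \<theta>))"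
    using \<theta> by (rule SUP_upper)
  also have "\<dots> \<le> 0"
    unfolding SUP_integral_centred[OF cons repr X A] by (intro SUP_least) simp
  finally have le: "(\<integral>\<omega>. f \<omega> \<partial>ext \<theta>) \<le> 0"
    using integral_centred_cond_exp(2)[OF cons \<theta> X Y A, of 0] by (simp add: f_def)
  have int: "integrable (ext \<theta>) f"
    unfolding f_def by (rule integral_centred_cond_exp(1)[OF cons \<theta> X Y A])
  have nonneg: "f \<omega> \<ge> 0" for \<omega>
    by (auto simp: f_def A_def indicator_def)
  have "(\<integral>\<omega>. f \<omega> \<partial>ext \<theta>) = 0"
    using le nonneg by (intro antisym integral_nonneg_AE) auto
  then have "AE \<omega> in ext \<theta>. f \<omega> = 0"
    using integral_nonneg_eq_0_iff_AE[OF int] nonneg by auto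
  then have "AE \<omega> in \<theta>. f \<omega> = 0" by (simp only: AE_ext_iff[OF \<theta>])
  moreover have "AE \<omega> in \<theta>. \<omega> \<in> space F" using Theta[OF \<theta>] AE_space[of \<theta>] by simp
  ultimately show ?thesis
    by eventually_elim (auto simp: f_def A_def indicator_def split: if_splits)
qed

text \<open>If \<open>W\<close> dominates every conditional expectation almost surely, then for \<open>c > 0\<close> and
  \<open>A = {W \<le> \<E>\<^sub>G X - c}\<close> each \<open>E\<^sub>\<theta>[I\<^sub>A (X - \<E>\<^sub>G X + c)]\<close> is nonpositive, whereas the supremum of
  these numbers is \<open>c\<close> times the supremum of \<open>\<theta>(A)\<close>; hence \<open>A\<close> is polar.\<close>

lemma consistent_le_upper_bound:
  fixes W :: "'a \<Rightarrow> ereal"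
  assumes cons: "consistent_expectation F G \<Theta> \<E> \<E>\<^sub>G" and repr: "represents F \<Theta> \<E>"
    and X: "X \<in> L1_space F \<Theta> F"
    and Y: "\<And>\<theta>. \<theta> \<in> \<Theta> \<Longrightarrow> is_cond_exp_version F G \<Theta> \<theta> X (Y \<theta>)"
    and W [measurable]: "W \<in> borel_measurable (qs_algebra G \<Theta>)"
    and ge: "\<And>\<theta>. \<theta> \<in> \<Theta> \<Longrightarrow> AE \<omega> in \<theta>. ereal (Y \<theta> \<omega>) \<le> W \<omega>"
  shows "quasi_surely F \<Theta> (\<lambda>\<omega>. ereal (\<E>\<^sub>G X \<omega>) \<le> W \<omega>)"
proof -
  have [measurable]: "\<E>\<^sub>G X \<in> borel_measurable (qs_algebra G \<Theta>)"
    using cons X by (auto simp: consistent_expectation_def L1_space_def)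
  define A where "A c = {\<omega> \<in> space (qs_algebra G \<Theta>). W \<omega> \<le> ereal (\<E>\<^sub>G X \<omega> - c)}" for c
  have A: "A c \<in> sets (qs_algebra G \<Theta>)" for c unfolding A_def by measurable
  have null: "AE \<omega> in \<theta>. \<omega> \<notin> A c" if \<theta>: "\<theta> \<in> \<Theta>" and c: "c > 0" for \<theta> c
  proof -
    interpret prob_space "ext \<theta>" by (rule prob_space_ext[OF \<theta>])
    have AM: "A c \<in> sets (ext \<theta>)"
      using A subalgebra_qs_algebra by (auto simp: subalgebra_def sets_ext[OF \<theta>])
    have "ereal (c * measure (ext \<theta>) (A c)) \<le> (SUP \<theta>\<in>\<Theta>. ereal (c * measure (ext \<theta>) (A c)))"
      using \<theta> by (rule SUP_upper)
    also have "\<dots> = (SUP \<theta>\<in>\<Theta>. ereal (\<integral>\<omega>. indicator (A c) \<omega> * (X \<omega> - \<E>\<^sub>G X \<omega> + c) \<partial>ext \<theta>))"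
      by (rule SUP_integral_centred[OF cons repr X A, symmetric])
    also have "\<dots> \<le> 0"
    proof (rule SUP_least)
      fix \<theta>' assume \<theta>': "\<theta>' \<in> \<Theta>"
      have "AE \<omega> in ext \<theta>'. indicator (A c) \<omega> * (Y \<theta>' \<omega> - \<E>\<^sub>G X \<omega> + c) \<le> 0"
        unfolding AE_ext_iff[OF \<theta>'] using ge[OF \<theta>']
      proof eventually_elim
        case (elim \<omega>)
        have "Y \<theta>' \<omega> \<le> \<E>\<^sub>G X \<omega> - c" if "\<omega> \<in> A c"
          using order_trans[OF elim, of "ereal (\<E>\<^sub>G X \<omega> - c)"] that by (simp add: A_def)
        then show ?case by (auto simp: indicator_def)
      qed
      then have "(\<integral>\<omega>. - (indicator (A c) \<omega> * (Y \<theta>' \<omega> - \<E>\<^sub>G X \<omega> + c)) \<partial>ext \<theta>') \<ge> 0"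
        by (intro integral_nonneg_AE) auto
      then show "ereal (\<integral>\<omega>. indicator (A c) \<omega> * (X \<omega> - \<E>\<^sub>G X \<omega> + c) \<partial>ext \<theta>') \<le> 0"
        by (simp add: integral_centred_cond_exp(2)[OF cons \<theta>' X Y[OF \<theta>'] A])
    qed
    finally have "measure (ext \<theta>) (A c) = 0"
      using c by (simp add: mult_le_0_iff measure_le_0_iff)
    then have "AE \<omega> in ext \<theta>. \<omega> \<notin> A c"
      using AM by (metis AE_iff_null_sets emeasure_eq_measure ennreal_0 null_setsI)
    then show ?thesis by (simp only: AE_ext_iff[OF \<theta>])
  qed
  show ?thesis
    unfolding quasi_surely_iff_AE
  proof
    fix \<theta> assume \<theta>: "\<theta> \<in> \<Theta>"
    have "AE \<omega> in \<theta>. \<forall>n. \<omega> \<notin> A (1 / real (Suc n))"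
      using null[OF \<theta>] by (simp add: AE_all_countable)
    moreover have "AE \<omega> in \<theta>. \<omega> \<in> space F" using Theta[OF \<theta>] AE_space[of \<theta>] by simp
    ultimately show "AE \<omega> in \<theta>. ereal (\<E>\<^sub>G X \<omega>) \<le> W \<omega>"
    proof eventually_elim
      case (elim \<omega>)
      then have *: "ereal (\<E>\<^sub>G X \<omega> - 1 / real (Suc n)) < W \<omega>" for n
        by (auto simp: A_def not_le)
      show ?case
      proof (cases "W \<omega>")
        case (real w)
        have "\<E>\<^sub>G X \<omega> \<le> w + e" if "e > 0" for e
        proof -
          obtain n where "1 / real (Suc n) < e"
            using nat_approx_posE[OF \<open>e > 0\<close>] by auto
          then show ?thesis using *[of n] real by simp
        qed
        then have "\<E>\<^sub>G X \<omega> \<le> w" by (rule field_le_epsilon)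
        with real show ?thesis by simp
      qed (use *[of 0] in auto)
    qed
  qed
qed

end

section \<open>Null sets inside the support\<close>

lemma sets_eq_if_borel_measurable_eq:
  assumes sp: "space M = space N"
    and eq: "(borel_measurable M :: ('a \<Rightarrow> real) set) = borel_measurable N"
  shows "sets M = sets N"
proof -
  have "A \<in> sets M'" if "A \<in> sets N'" "space M' = space N'"
    "(borel_measurable N' :: ('a \<Rightarrow> real) set) = borel_measurable M'" for A and M' N' :: "'a measure"
  proof -
    have "(indicator A :: 'a \<Rightarrow> real) \<in> borel_measurable N'"
      using that(1) by (rule borel_measurable_indicator)
    then have "A \<inter> space M' \<in> sets M'"
      by (simp add: that(3) borel_measurable_indicator_iff)
    then show ?thesis
      using sets.sets_into_space[OF that(1)] that(2) by (simp add: Int_absorb2)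
  qed
  then show ?thesis using sp eq by blast
qed

context prob_family
begin

text \<open>The only place where the Hahn property enters: within the support of \<open>\<theta>\<close>, a
  \<open>\<theta>\<close>-null set of \<open>\<G>\<^sup>\<Theta>\<close> is polar. On such a set \<open>A\<close> every density of \<open>\<theta>\<close> vanishes:
  almost surely under its own \<open>\<phi>\<close> because \<open>\<theta>(A) = 0\<close>, and under the other members of \<open>\<Phi>\<close>
  because it is cut off outside \<open>S \<phi>\<close>.\<close>

lemma support_null_imp_qs:
  assumes hahn: "hahn_property_with G \<Theta> \<Phi> S" and \<theta>: "\<theta> \<in> \<Theta>"
    and supp: "is_qs_support F G \<Theta> \<Phi> S \<theta> T"
    and A: "A \<in> sets (qs_algebra G \<Theta>)" and AT: "A \<subseteq> T" and null: "AE \<omega> in \<theta>. \<omega> \<notin> A"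
  shows "quasi_surely F \<Theta> (\<lambda>\<omega>. \<omega> \<notin> A)"
proof -
  have Phi: "prob_space \<phi>" "space \<phi> = space G" "sets \<phi> = sets G" if "\<phi> \<in> \<Phi>" for \<phi>
    using hahn that by (auto simp: hahn_property_with_def)
  have polar_eq: "polar G \<Phi> N \<longleftrightarrow> polar G \<Theta> N" for N
    using hahn by (simp add: hahn_property_with_def)
  have S: "S \<phi> \<in> sets (qs_algebra G \<Theta>)" "emeasure (qs_extension G \<Phi> \<phi>) (S \<phi>) = 1"
    if "\<phi> \<in> \<Phi>" for \<phi>
    using hahn that by (auto simp: hahn_property_with_def)
  have disj: "S \<phi> \<inter> S \<phi>' = {}" if "\<phi> \<in> \<Phi>" "\<phi>' \<in> \<Phi>" "\<phi> \<noteq> \<phi>'" for \<phi> \<phi>'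
    using hahn that by (auto simp: hahn_property_with_def disjoint_family_on_def)
  have sets_eq: "sets (qs_algebra G \<Phi>) = sets (qs_algebra G \<Theta>)"
    using hahn by (intro sets_eq_if_borel_measurable_eq) (auto simp: hahn_property_with_def)
  have subPhi: "subalgebra \<phi> G" if "\<phi> \<in> \<Phi>" for \<phi>
    using Phi[OF that] by (auto simp: subalgebra_def)
  have restrPhi: "restr_to_subalg \<phi> G = \<phi>" if "\<phi> \<in> \<Phi>" for \<phi>
    using Phi[OF that] by (intro restr_to_subalg_sets_eq) auto
  define E where "E = qs_extension G \<Phi>"
  have setsE: "sets (E \<phi>) = sets (qs_algebra G \<Theta>)" if "\<phi> \<in> \<Phi>" for \<phi>
    using sets_qs_extension[OF subPhi that] sets_eq by (simp add: E_def)
  have AE_E: "(AE \<omega> in E \<phi>. P \<omega>) \<longleftrightarrow> (AE \<omega> in \<phi>. P \<omega>)" if "\<phi> \<in> \<Phi>" for \<phi> P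
    using AE_qs_extension_iff[OF subPhi that] unfolding restrPhi[OF that] E_def by blast
  have probE: "prob_space (E \<phi>)" if "\<phi> \<in> \<Phi>" for \<phi>
    unfolding E_def by (rule prob_space_qs_extension[OF subPhi that Phi(1)[OF that]])
  have AE_S: "AE \<omega> in \<phi>. \<omega> \<in> S \<phi>" if "\<phi> \<in> \<Phi>" for \<phi>
  proof -
    interpret prob_space "E \<phi>" by (rule probE[OF that])
    have "AE \<omega> in E \<phi>. \<omega> \<in> S \<phi>"
      using S[OF that] by (intro AE_prob_1) (simp add: E_def measure_def)
    then show ?thesis by (simp only: AE_E[OF that])
  qed
  \<comment> \<open>Subsets of \<open>S \<phi>\<close> are null for every other member of \<open>\<Phi>\<close>.\<close>
  have polar_in_S: "polar G \<Theta> N" if \<phi>: "\<phi> \<in> \<Phi>" and N: "N \<subseteq> S \<phi>" "AE \<omega> in \<phi>. \<omega> \<notin> N" for N \<phi>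
  proof -
    have "AE \<omega> in restr_to_subalg \<phi>' G. \<omega> \<notin> N" if \<phi>': "\<phi>' \<in> \<Phi>" for \<phi>'
    proof (cases "\<phi>' = \<phi>")
      case False
      show ?thesis
        unfolding restrPhi[OF \<phi>'] using AE_S[OF \<phi>']
        by eventually_elim (use disj[OF \<phi>' \<phi> False] N in auto)
    next
      case True
      show ?thesis using N(2) unfolding True restrPhi[OF \<phi>] .
    qed
    moreover have "N \<subseteq> space G"
      using N(1) sets.sets_into_space[OF S(1)[OF \<phi>]] by auto
    ultimately show ?thesis
      unfolding polar_eq[symmetric] by (subst polar_iff_AE[OF subPhi]) auto
  qed
  define K where "K = qs_extension G \<Theta> \<theta>"
  have setsK: "sets K = sets (qs_algebra G \<Theta>)"
    unfolding K_def by (rule sets_qs_extension[OF subG \<theta>])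
  have AE_K: "(AE \<omega> in K. \<omega> \<notin> B) \<longleftrightarrow> (AE \<omega> in \<theta>. \<omega> \<notin> B)" if "B \<in> sets (qs_algebra G \<Theta>)" for B
    unfolding K_def AE_qs_extension_G_iff[OF \<theta>] by (rule AE_restr_not_in_iff[OF that \<theta>])
  have density_null: "quasi_surely F \<Theta> (\<lambda>\<omega>. \<omega> \<in> A \<longrightarrow> hahn_density G \<Theta> \<Phi> S \<theta> \<phi> \<omega> = 0)"
    if \<phi>: "\<phi> \<in> \<Phi>" for \<phi>
  proof -
    interpret E: prob_space "E \<phi>" by (rule probE[OF \<phi>])
    note [measurable] = A S(1)[OF \<phi>]
    have AK: "A \<in> sets K" "S \<phi> \<in> sets K" using A S(1)[OF \<phi>] by (simp_all add: setsK)
    have AEs: "A \<in> sets (E \<phi>)" "S \<phi> \<in> sets (E \<phi>)" using A S(1)[OF \<phi>] by (simp_all add: setsE[OF \<phi>])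
    define \<nu> where "\<nu> = density K (indicator (S \<phi>))"
    have \<nu>: "emeasure \<nu> B = emeasure K (S \<phi> \<inter> B)" if "B \<in> sets (qs_algebra G \<Theta>)" for B
      using that AK(2) setsK unfolding \<nu>_def
      by (subst emeasure_density) (auto simp: indicator_inter_arith[symmetric])
    \<comment> \<open>A \<open>\<phi>\<close>-null subset of \<open>S \<phi>\<close> is polar, hence \<open>\<theta>\<close>-null, so \<^const>\<open>RN_deriv\<close> is a genuine
      density here.\<close>
    have ac: "absolutely_continuous (E \<phi>) \<nu>"
      unfolding absolutely_continuous_def
    proof
      fix B assume B: "B \<in> null_sets (E \<phi>)"
      then have Bs: "B \<in> sets (qs_algebra G \<Theta>)" by (auto simp: null_sets_def setsE[OF \<phi>])
      have "AE \<omega> in \<phi>. \<omega> \<notin> S \<phi> \<inter> B"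
        using AE_not_in[OF B] unfolding AE_E[OF \<phi>] by eventually_elim auto
      from polar_in_S[OF \<phi> _ this] have "polar G \<Theta> (S \<phi> \<inter> B)" by auto
      moreover have SB: "S \<phi> \<inter> B \<in> sets (qs_algebra G \<Theta>)" using Bs S(1)[OF \<phi>] by auto
      ultimately have "emeasure K (S \<phi> \<inter> B) = 0"
        using \<theta> by (simp add: polar_def K_def)
      then show "B \<in> null_sets \<nu>"
        using \<nu>[OF Bs] Bs by (simp add: null_sets_def \<nu>_def setsK)
    qed
    define D where "D = RN_deriv (E \<phi>) \<nu>"
    have D: "density (E \<phi>) D = \<nu>"
      unfolding D_def by (rule E.density_RN_deriv[OF ac]) (simp add: \<nu>_def setsK setsE[OF \<phi>])
    have Dm [measurable]: "D \<in> borel_measurable (E \<phi>)" unfolding D_def by simp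
    have SA: "S \<phi> \<inter> A \<in> sets (qs_algebra G \<Theta>)" using A S(1)[OF \<phi>] by auto
    have "AE \<omega> in K. \<omega> \<notin> S \<phi> \<inter> A"
      unfolding AE_K[OF SA] using null by eventually_elim auto
    then have "emeasure K (S \<phi> \<inter> A) = 0"
      using SA setsK by (metis AE_iff_null_sets null_setsD1)
    then have "(\<integral>\<^sup>+\<omega>. D \<omega> * indicator A \<omega> \<partial>E \<phi>) = 0"
      using \<nu>[OF A] emeasure_density[OF Dm AEs(1)] by (simp add: D)
    then have "AE \<omega> in E \<phi>. D \<omega> * indicator A \<omega> = 0"
      using AEs(1) by (subst (asm) nn_integral_0_iff_AE) auto
    then have "AE \<omega> in \<phi>. \<omega> \<notin> {\<omega> \<in> S \<phi>. \<omega> \<in> A \<and> D \<omega> \<noteq> 0}"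
      unfolding AE_E[OF \<phi>] by eventually_elim auto
    from polar_in_S[OF \<phi> _ this]
    have p: "polar G \<Theta> {\<omega> \<in> S \<phi>. \<omega> \<in> A \<and> D \<omega> \<noteq> 0}" by auto
    then have "{\<omega> \<in> S \<phi>. \<omega> \<in> A \<and> D \<omega> \<noteq> 0} \<in> sets (qs_algebra G \<Theta>)" by (simp add: polar_def)
    from polar_G_iff_AE[OF this] p
    have *: "\<forall>\<theta>\<in>\<Theta>. AE \<omega> in \<theta>. \<omega> \<notin> {\<omega> \<in> S \<phi>. \<omega> \<in> A \<and> D \<omega> \<noteq> 0}" by simp
    have hd: "hahn_density G \<Theta> \<Phi> S \<theta> \<phi> \<omega> = enn2ereal (D \<omega> * indicator (S \<phi>) \<omega>)" for \<omega>
      by (simp add: hahn_density_def D_def E_def K_def \<nu>_def)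
    show ?thesis
      unfolding quasi_surely_iff_AE hd
    proof
      fix \<theta>' assume "\<theta>' \<in> \<Theta>"
      with * have "AE \<omega> in \<theta>'. \<omega> \<notin> {\<omega> \<in> S \<phi>. \<omega> \<in> A \<and> D \<omega> \<noteq> 0}" by blast
      then show "AE \<omega> in \<theta>'. \<omega> \<in> A \<longrightarrow> enn2ereal (D \<omega> * indicator (S \<phi>) \<omega>) = 0"
        by eventually_elim (auto simp: indicator_def zero_ennreal.rep_eq)
    qed
  qed
  obtain L where L: "is_qs_ess_sup F G \<Theta> (hahn_density G \<Theta> \<Phi> S \<theta> ` \<Phi>) L"
    and T: "T = {\<omega> \<in> space F. L \<omega> > 0}"
    using supp by (auto simp: is_qs_support_def)
  have Lm [measurable]: "L \<in> borel_measurable (qs_algebra G \<Theta>)"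
    using L by (simp add: is_qs_ess_sup_def)
  define L' where "L' = (\<lambda>\<omega>. if \<omega> \<in> A then 0 else L \<omega>)"
  \<comment> \<open>Lowering \<open>L\<close> to \<open>0\<close> on \<open>A\<close> keeps it above every density, so minimality of \<open>L\<close> forces
    \<open>L \<le> 0\<close> quasi-surely on \<open>A\<close>, although \<open>L > 0\<close> on \<open>T\<close>.\<close>
  have "L' \<in> borel_measurable (qs_algebra G \<Theta>)"
    unfolding L'_def using A by measurable
  moreover have "quasi_surely F \<Theta> (\<lambda>\<omega>. L' \<omega> \<ge> h \<omega>)"
    if h_in: "h \<in> hahn_density G \<Theta> \<Phi> S \<theta> ` \<Phi>" for h
  proof -
    obtain \<phi> where \<phi>: "\<phi> \<in> \<Phi>" and h: "h = hahn_density G \<Theta> \<Phi> S \<theta> \<phi>"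
      using h_in by blast
    have "quasi_surely F \<Theta> (\<lambda>\<omega>. L \<omega> \<ge> h \<omega>)"
      using L h_in unfolding is_qs_ess_sup_def by blast
    with density_null[OF \<phi>] show ?thesis
      unfolding quasi_surely_iff_AE
    proof (intro ballI)
      fix \<theta>' assume "\<theta>' \<in> \<Theta>" and
        1: "\<forall>\<theta>'\<in>\<Theta>. AE \<omega> in \<theta>'. \<omega> \<in> A \<longrightarrow> hahn_density G \<Theta> \<Phi> S \<theta> \<phi> \<omega> = 0"
          "\<forall>\<theta>'\<in>\<Theta>. AE \<omega> in \<theta>'. h \<omega> \<le> L \<omega>"
      from 1(1)[rule_format, OF this(1)] 1(2)[rule_format, OF this(1)]
      show "AE \<omega> in \<theta>'. h \<omega> \<le> L' \<omega>"
        by eventually_elim (auto simp: L'_def h)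
    qed
  qed
  ultimately have "quasi_surely F \<Theta> (\<lambda>\<omega>. L' \<omega> \<ge> L \<omega>)"
    using L unfolding is_qs_ess_sup_def by blast
  then show ?thesis
    by (rule quasi_surely_mono) (use AT T in \<open>auto simp: L'_def split: if_splits\<close>)
qed

end

section \<open>The conditional map as an essential supremum\<close>

theorem theorem5:
  fixes F G :: "'a measure" and \<Theta> \<Phi> :: "'a measure set"
    and S T :: "'a measure \<Rightarrow> 'a set"
    and \<E> :: "('a \<Rightarrow> real) \<Rightarrow> ereal" and \<E>\<^sub>G :: "('a \<Rightarrow> real) \<Rightarrow> ('a \<Rightarrow> real)"
    and X :: "'a \<Rightarrow> real" and Y :: "'a measure \<Rightarrow> 'a \<Rightarrow> real"
  assumes sub: "subalgebra F G"
    and Theta: "\<And>\<theta>. \<theta> \<in> \<Theta> \<Longrightarrow> prob_space \<theta> \<and> space \<theta> = space F \<and> sets \<theta> = sets F"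
    and coherent: "coherent_sublinear_expectation F \<Theta> \<E>"
    and consistent: "consistent_expectation F G \<Theta> \<E> \<E>\<^sub>G"
    and repr: "represents F \<Theta> \<E>"
    and hahn: "hahn_property_with G \<Theta> \<Phi> S"
    and supp: "\<And>\<theta>. \<theta> \<in> \<Theta> \<Longrightarrow> is_qs_support F G \<Theta> \<Phi> S \<theta> (T \<theta>)"
    and supp_full: "\<And>\<theta>. \<theta> \<in> \<Theta> \<Longrightarrow> emeasure (qs_extension G \<Theta> \<theta>) (T \<theta>) = 1"
    and X: "X \<in> L1_space F \<Theta> F"
    and Y: "\<And>\<theta>. \<theta> \<in> \<Theta> \<Longrightarrow> is_cond_exp_version F G \<Theta> \<theta> X (Y \<theta>)"
  shows "\<exists>Z. is_qs_ess_sup F G \<Theta> ((\<lambda>\<theta>. qs_cond_exp (T \<theta>) (Y \<theta>)) ` \<Theta>) Z \<and>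
             quasi_surely F \<Theta> (\<lambda>\<omega>. ereal (\<E>\<^sub>G X \<omega>) = Z \<omega>)"
proof -
  interpret prob_family F G \<Theta>
    using sub Theta by unfold_locales auto
  have EX [measurable]: "\<E>\<^sub>G X \<in> borel_measurable (qs_algebra G \<Theta>)"
    using consistent X by (auto simp: consistent_expectation_def L1_space_def)
  have upper: "quasi_surely F \<Theta> (\<lambda>\<omega>. qs_cond_exp (T \<theta>) (Y \<theta>) \<omega> \<le> ereal (\<E>\<^sub>G X \<omega>))"
    if \<theta>: "\<theta> \<in> \<Theta>" for \<theta>
  proof -
    obtain L where L: "L \<in> borel_measurable (qs_algebra G \<Theta>)" "T \<theta> = {\<omega> \<in> space F. (0::ereal) < L \<omega>}"
      using supp[OF \<theta>] by (auto simp: is_qs_support_def is_qs_ess_sup_def)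
    note [measurable] = L(1)
    have [measurable]: "Y \<theta> \<in> borel_measurable (qs_algebra G \<Theta>)"
      using Y[OF \<theta>] by (simp add: is_cond_exp_version_def)
    \<comment> \<open>\<open>\<theta>\<close>-almost surely the inequality needs no support; cutting the exceptional set down to
      \<open>T \<theta>\<close> makes it polar.\<close>
    define A where "A = {\<omega> \<in> space (qs_algebra G \<Theta>). 0 < L \<omega> \<and> \<E>\<^sub>G X \<omega> < Y \<theta> \<omega>}"
    have "A \<in> sets (qs_algebra G \<Theta>)" unfolding A_def by measurable
    moreover have "A \<subseteq> T \<theta>" by (auto simp: A_def L(2))
    moreover have "AE \<omega> in \<theta>. \<omega> \<notin> A"
      using cond_exp_le_consistent_AE[OF consistent repr X \<theta> Y[OF \<theta>]]
      by eventually_elim (auto simp: A_def)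
    ultimately have "quasi_surely F \<Theta> (\<lambda>\<omega>. \<omega> \<notin> A)"
      by (rule support_null_imp_qs[OF hahn \<theta> supp[OF \<theta>]])
    then show ?thesis
      by (rule quasi_surely_mono) (auto simp: A_def L(2) qs_cond_exp_def)
  qed
  have AE_T: "AE \<omega> in \<theta>. \<omega> \<in> T \<theta>" if \<theta>: "\<theta> \<in> \<Theta>" for \<theta>
  proof -
    interpret K: prob_space "qs_extension G \<Theta> \<theta>"
      by (rule prob_space_qs_extension[OF subG \<theta>]) (use Theta[OF \<theta>] in auto)
    have "AE \<omega> in qs_extension G \<Theta> \<theta>. \<omega> \<in> T \<theta>"
      using supp_full[OF \<theta>] by (intro K.AE_prob_1) (simp add: measure_def)
    then show ?thesis
      unfolding AE_qs_extension_G_iff[OF \<theta>] by (rule AE_restr_to_subalg[OF subG[OF \<theta>]])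
  qed
  have least: "quasi_surely F \<Theta> (\<lambda>\<omega>. ereal (\<E>\<^sub>G X \<omega>) \<le> W \<omega>)"
    if "W \<in> borel_measurable (qs_algebra G \<Theta>)"
      and W: "\<And>\<theta>. \<theta> \<in> \<Theta> \<Longrightarrow> quasi_surely F \<Theta> (\<lambda>\<omega>. qs_cond_exp (T \<theta>) (Y \<theta>) \<omega> \<le> W \<omega>)" for W
  proof (rule consistent_le_upper_bound[OF consistent repr X Y that(1)])
    fix \<theta> assume \<theta>: "\<theta> \<in> \<Theta>"
    have "AE \<omega> in \<theta>. qs_cond_exp (T \<theta>) (Y \<theta>) \<omega> \<le> W \<omega>"
      using W[OF \<theta>] \<theta> by (simp add: quasi_surely_iff_AE)
    with AE_T[OF \<theta>] show "AE \<omega> in \<theta>. ereal (Y \<theta> \<omega>) \<le> W \<omega>"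
      by eventually_elim (simp add: qs_cond_exp_def)
  qed
  have "is_qs_ess_sup F G \<Theta> ((\<lambda>\<theta>. qs_cond_exp (T \<theta>) (Y \<theta>)) ` \<Theta>) (\<lambda>\<omega>. ereal (\<E>\<^sub>G X \<omega>))"
    unfolding is_qs_ess_sup_def using upper least by auto
  moreover have "quasi_surely F \<Theta> (\<lambda>\<omega>. ereal (\<E>\<^sub>G X \<omega>) = ereal (\<E>\<^sub>G X \<omega>))"
    by (simp add: quasi_surely_iff_AE)
  ultimately show ?thesis by blast
qed

end
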